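(* There exist functions $f, F$ analytic and univalent in $\mathbb D$ such that $F$ is convexity preserving and such that the inequality $\bigl(\log|f\star F|\bigr)^*\le\bigl(\log|f|\bigr)^*$ in $\mathbb D^+$ does not hold.
   Context: $\mathbb D=\{z\in\mathbb C:|z|<1\}$ and $\mathbb D^+=\{re^{i\theta}:0<r<1,\ 0<\theta<\pi\}$. Univalent means injective. For $f(z)=\sum_{n\ge0}a_nz^n$ and $g(z)=\sum_{n\ge0}b_nz^n$ analytic in $\mathbb D$, the (Hadamard) convolution is $(f\star g)(z)=\sum_{n\ge0}a_nb_nz^n$, $z\in\mathbb D$. An analytic function $F$ in $\mathbb D$ is convexity preserving if for every analytic $f$ in $\mathbb D$ the range of $f\star F$ is contained in the closed convex hull of the range of $f$. If $u$ is subharmonic in $\mathbb D\setminus\{0\}$, its Baernstein star-function is $$u^*(re^{i\theta})=\sup_{|E|=2\theta}\int_E u(re^{it})\,dt,\qquad 0<r<1,\ 0\le\theta\le\pi,$$ where the supremum is over measurable sets $E\subset[-\pi,\pi]$ and $|E|$ is the Lebesgue measure of $E$. The star-function is applied to $u=\log|f|$ with $f$ analytic and not identically zero (a subharmonic function). An inequality $u^*\le v^*$ between star-functions means that it holds at every point of $\mathbb D^+$; saying it does not hold means that it fails at some point of $\mathbb D^+$. *)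

theory Defs
  imports "HOL-Complex_Analysis.Complex_Analysis"
begin

abbreviation unit_disc :: "complex set" where
  "unit_disc \<equiv> ball 0 1"

definition upper_half_disc :: "complex set" where
  "upper_half_disc = {rcis r \<theta> | r \<theta>. 0 < r \<and> r < 1 \<and> 0 < \<theta> \<and> \<theta> < pi}"

definition univalent_on :: "(complex \<Rightarrow> complex) \<Rightarrow> complex set \<Rightarrow> bool" where
  "univalent_on f S \<longleftrightarrow> f holomorphic_on S \<and> inj_on f S"

definition hadamard :: "(complex \<Rightarrow> complex) \<Rightarrow> (complex \<Rightarrow> complex) \<Rightarrow> complex \<Rightarrow> complex"
  (infixl \<open>\<star>\<close> 70) where
  "(f \<star> g) z = (\<Sum>n. fps_nth (fps_expansion f 0) n * fps_nth (fps_expansion g 0) n * z ^ n)"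

definition convexity_preserving :: "(complex \<Rightarrow> complex) \<Rightarrow> bool" where
  "convexity_preserving F \<longleftrightarrow>
     F holomorphic_on unit_disc \<and>
     (\<forall>f. f holomorphic_on unit_disc \<longrightarrow>
        (f \<star> F) ` unit_disc \<subseteq> closure (convex hull (f ` unit_disc)))"

text \<open>
  Subharmonic functions take values in \<open>[-\<infinity>, \<infinity>)\<close>, hence the type \<^typ>\<open>ereal\<close>. The integral is the
  difference of the integrals of the positive and the negative part; on a circle inside the
  punctured disc the former is finite, because a subharmonic function is bounded above there.
\<close>

definition ereal_integral :: "real set \<Rightarrow> (real \<Rightarrow> ereal) \<Rightarrow> ereal" where
  "ereal_integral E h =
     enn2ereal (\<integral>\<^sup>+t\<in>E. e2ennreal (h t) \<partial>lebesgue) - enn2ereal (\<integral>\<^sup>+t\<in>E. e2ennreal (- h t) \<partial>lebesgue)"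

lemma ereal_integral_eq_set_integral:
  fixes h :: "real \<Rightarrow> real"
  assumes "set_integrable lebesgue E h"
  shows "ereal_integral E (\<lambda>t. ereal (h t)) = ereal (LINT t:E|lebesgue. h t)"
proof -
  let ?g = "\<lambda>t. indicator E t *\<^sub>R h t"
  have int: "integrable lebesgue ?g"
    using assms by (simp add: set_integrable_def)
  have fin: "(\<integral>\<^sup>+t. ennreal (?g t) \<partial>lebesgue) < \<infinity>" "(\<integral>\<^sup>+t. ennreal (- ?g t) \<partial>lebesgue) < \<infinity>"
    using int by (auto simp: real_integrable_def top.not_eq_extremum)
  have pos: "(\<integral>\<^sup>+t\<in>E. e2ennreal (ereal (h t)) \<partial>lebesgue) = (\<integral>\<^sup>+t. ennreal (?g t) \<partial>lebesgue)"
    by (intro nn_integral_cong) (auto simp: indicator_def)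
  have neg: "(\<integral>\<^sup>+t\<in>E. e2ennreal (- ereal (h t)) \<partial>lebesgue) = (\<integral>\<^sup>+t. ennreal (- ?g t) \<partial>lebesgue)"
    by (intro nn_integral_cong) (auto simp: indicator_def)
  have "(LINT t:E|lebesgue. h t) =
      enn2real (\<integral>\<^sup>+t. ennreal (?g t) \<partial>lebesgue) - enn2real (\<integral>\<^sup>+t. ennreal (- ?g t) \<partial>lebesgue)"
    unfolding set_lebesgue_integral_def by (rule real_lebesgue_integral_def[OF int])
  moreover have "enn2ereal x = ereal (enn2real x)" if "x < \<infinity>" for x
    using that by (cases x) (auto simp: enn2ereal_ennreal)
  ultimately show ?thesis
    unfolding ereal_integral_def pos neg using fin by simp
qed

text \<open>
  The star-function at \<open>z = r e\<^sup>i\<^sup>\<theta>\<close>, where \<open>r = cmod z\<close> and \<open>\<theta> = Arg z\<close>;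
  it is meant for \<open>0 < r < 1\<close> and \<open>0 \<le> \<theta> \<le> pi\<close>.
\<close>

definition baernstein_star :: "(complex \<Rightarrow> ereal) \<Rightarrow> complex \<Rightarrow> ereal" where
  "baernstein_star u z =
     (SUP E \<in> {E \<in> sets lebesgue. E \<subseteq> {-pi..pi} \<and> emeasure lebesgue E = ennreal (2 * Arg z)}.
        ereal_integral E (\<lambda>t. u (rcis (cmod z) t)))"

definition log_abs :: "(complex \<Rightarrow> complex) \<Rightarrow> complex \<Rightarrow> ereal" where
  "log_abs f z = (if f z = 0 then - \<infinity> else ereal (ln (cmod (f z))))"

end

theory Submission
  imports Defs
begin

text \<open>
  Take \<open>F(z) = 1 + z/2\<close> and the nonvanishing shifted Koebe function \<open>f(z) = ((1+z)/(1-z))\<^sup>2\<close>, so that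
  \<open>(f \<star> F)(z) = 1 + 2z\<close>. \<open>F\<close> preserves convexity because \<open>(f \<star> F)(z)\<close> is the average of
  \<open>f(z e\<^sup>i\<^sup>t)\<close> against the probability density \<open>(1 + cos t)/2\<pi>\<close>. Since \<open>f\<close> has no zeros, the mean of
  \<open>log |f|\<close> over any circle is \<open>log |f(0)| = 0\<close>, whereas \<open>1 + 2z\<close> vanishes at \<open>-1/2\<close>, so its logarithm has
  mean \<open>log (3/2) > 0\<close> over the circle of radius \<open>3/4\<close>. At \<open>\<theta> = \<pi>\<close> the star-functions are these means
  (times \<open>2\<pi>\<close>), and they change little for \<open>\<theta>\<close> slightly smaller than \<open>\<pi>\<close>.
\<close>

section \<open>Mean values over circles\<close>

text \<open>With \<open>u = cis t\<close> the weight is \<open>1 + (u + 1/u) / 2\<close> and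
  \<open>dt = du / (\<i> u)\<close>, so the integral combines the contour integrals of
  \<open>h u / u\<close>, \<open>h u\<close> and \<open>h u / u ^ 2\<close>, which Cauchy's formulas
  and Cauchy's theorem evaluate.\<close>

lemma circle_integral_kernel:
  fixes h :: "complex \<Rightarrow> complex"
  assumes "h holomorphic_on cball 0 1"
  shows "((\<lambda>t. h (cis t) * of_real (1 + cos t)) has_integral 2 * pi * (h 0 + deriv h 0 / 2)) {0..2*pi}"
proof -
  have hol: "h holomorphic_on ball 0 1" and cont: "continuous_on (cball 0 1) h"
    using assms holomorphic_on_subset holomorphic_on_imp_continuous_on by auto
  have "((\<lambda>u. h u / u) has_contour_integral 2 * of_real pi * \<i> * h 0) (circlepath 0 1)"
    using Cauchy_integral_circlepath[OF cont hol, of 0] by simp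
  moreover have "((\<lambda>u. h u / u ^ 2) has_contour_integral 2 * of_real pi * \<i> * deriv h 0) (circlepath 0 1)"
    using Cauchy_has_contour_integral_higher_derivative_circlepath[OF cont hol, of 0 1]
    by (simp add: numeral_2_eq_2)
  moreover have "(h has_contour_integral 0) (circlepath 0 1)"
    by (rule Cauchy_theorem_convex_simple[where S = "cball 0 1"]) (use assms in auto)
  ultimately have "((\<lambda>u. h u / u + (h u + h u / u ^ 2) / 2) has_contour_integral
      2 * of_real pi * \<i> * h 0 + (0 + 2 * of_real pi * \<i> * deriv h 0) / 2) (circlepath 0 1)"
    by (intro has_contour_integral_add has_contour_integral_div)
  hence "((\<lambda>t. (h (cis t) / cis t + (h (cis t) + h (cis t) / cis t ^ 2) / 2) * \<i> * cis t) has_integral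
      2 * of_real pi * \<i> * h 0 + (0 + 2 * of_real pi * \<i> * deriv h 0) / 2) {0..2*pi}"
    by (simp add: circlepath_def has_contour_integral_part_circlepath_iff)
  from has_integral_mult_right[OF this, of "-\<i>"]
  have *: "((\<lambda>t. -\<i> * ((h (cis t) / cis t + (h (cis t) + h (cis t) / cis t ^ 2) / 2) * \<i> * cis t))
      has_integral 2 * pi * (h 0 + deriv h 0 / 2)) {0..2*pi}"
    by (simp add: algebra_simps add_divide_distrib)
  have "-\<i> * ((w / cis t + (w + w / cis t ^ 2) / 2) * \<i> * cis t) = w * of_real (1 + cos t)" for w t
  proof -
    have "-\<i> * ((w / cis t + (w + w / cis t ^ 2) / 2) * \<i> * cis t) = w * (1 + (cis t + 1 / cis t) / 2)"
      by (simp add: field_simps power2_eq_square)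
    also have "1 / cis t = cis (-t)"
      by (simp add: divide_inverse)
    also have "(cis t + cis (-t)) / 2 = of_real (cos t)"
      by (simp add: complex_eq_iff)
    finally show ?thesis by simp
  qed
  with * show ?thesis by (simp only: )
qed

lemma circle_mean_value:
  fixes g :: "complex \<Rightarrow> complex"
  assumes "g holomorphic_on cball 0 r" "0 < r"
  shows "((\<lambda>t. g (rcis r t)) has_integral 2 * pi * g 0) {-pi..pi}"
proof -
  \<comment> \<open>The circle is parametrized over \<open>{0..2*pi}\<close>, the star-function over
    \<open>{-pi..pi}\<close>. Shifting \<open>t\<close> by \<open>pi\<close> negates the point, and
    the reflection \<open>k\<close> undoes this.\<close>
  define k where "k = (\<lambda>z. g (- z))"
  have "k holomorphic_on cball 0 r"
    unfolding k_def using assms(1)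
    by (intro holomorphic_on_compose_gen[of uminus _ g, unfolded o_def] holomorphic_intros) auto
  from Cauchy_integral_circlepath_simple[OF this, of 0] assms(2)
  have "((\<lambda>u. k u / u) has_contour_integral 2 * of_real pi * \<i> * k 0) (circlepath 0 r)"
    by simp
  hence "((\<lambda>t. k (r * cis t) / (r * cis t) * r * \<i> * cis t) has_integral 2 * of_real pi * \<i> * k 0) {0..2*pi}"
    unfolding circlepath_def by (subst (asm) has_contour_integral_part_circlepath_iff) auto
  from has_integral_mult_right[OF this, of "-\<i>"]
  have "((\<lambda>t. k (r * cis t)) has_integral 2 * pi * k 0) {0..2*pi}"
    using assms(2) by (simp add: algebra_simps)
  hence "((\<lambda>t. k (r * cis t)) \<circ> (+) pi has_integral 2 * pi * k 0) {-pi..pi}"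
    by (subst has_integral_shift_Icc_real) simp
  moreover have "((\<lambda>t. k (r * cis t)) \<circ> (+) pi) = (\<lambda>t. g (rcis r t))"
    by (auto simp: k_def rcis_def fun_eq_iff simp flip: cis_mult)
  ultimately show ?thesis by (simp add: k_def)
qed

text \<open>A zero-free \<open>h\<close> on a disc is \<open>exp g\<close> with \<open>g\<close>
  holomorphic, so \<open>ln (cmod (h z))\<close> is the real part of \<open>g\<close> and inherits
  its mean value property.\<close>

lemma log_mean_value:
  assumes "h holomorphic_on ball 0 R" "\<And>z. z \<in> ball 0 R \<Longrightarrow> h z \<noteq> 0" "0 < r" "r < R"
  shows "((\<lambda>t. ln (cmod (h (rcis r t)))) has_integral 2 * pi * ln (cmod (h 0))) {-pi..pi}"
proof -
  obtain g where g: "g holomorphic_on ball 0 R" "\<And>z. z \<in> ball 0 R \<Longrightarrow> h z = exp (g z)"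
    using contractible_imp_holomorphic_log[OF assms(1) convex_imp_contractible[OF convex_ball] assms(2)]
    by metis
  have ln: "ln (cmod (h z)) = Re (g z)" if "z \<in> ball 0 R" for z
    using g(2)[OF that] by simp
  have "g holomorphic_on cball 0 r"
    using g(1) by (rule holomorphic_on_subset) (use assms in auto)
  from has_integral_Re[OF circle_mean_value[OF this assms(3)]]
  show ?thesis
    using assms(3,4) by (subst ln) (auto simp: ln Re_divide)
qed

section \<open>Convolution with \<open>1 + z/2\<close>\<close>

lemma hadamard_linear:
  "(f \<star> (\<lambda>z. 1 + z / 2)) z = f 0 + deriv f 0 * z / 2"
proof -
  have F: "fps_expansion (\<lambda>z::complex. 1 + z / 2) 0 = 1 + fps_const (1 / 2) * fps_X"
  proof (rule fps_ext)
    fix n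
    have "(\<lambda>z::complex. 1 + 1 / 2 * z) has_fps_expansion 1 + fps_const (1 / 2) * fps_X"
      by (intro fps_expansion_intros)
    from fps_nth_fps_expansion[OF this]
    show "fps_nth (fps_expansion (\<lambda>z::complex. 1 + z / 2) 0) n = fps_nth (1 + fps_const (1 / 2) * fps_X) n"
      by (simp add: fps_expansion_def)
  qed
  have "(f \<star> (\<lambda>z. 1 + z / 2)) z =
    (\<Sum>n\<in>{0,1}. fps_nth (fps_expansion f 0) n * fps_nth (fps_expansion (\<lambda>z. 1 + z / 2) 0) n * z ^ n)"
    unfolding hadamard_def by (rule suminf_finite) (auto simp: F)
  moreover have "fps_nth (fps_expansion f 0) 0 = f 0" "fps_nth (fps_expansion f 0) 1 = deriv f 0"
    by (simp_all add: fps_expansion_def)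
  ultimately show ?thesis by (simp add: F)
qed


lemma convexity_preserving_linear: "convexity_preserving (\<lambda>z. 1 + z / 2)"
  unfolding convexity_preserving_def
proof (intro conjI allI impI subsetI)
  show "(\<lambda>z. 1 + z / 2 :: complex) holomorphic_on unit_disc"
    by (intro holomorphic_intros) auto
next
  fix f :: "complex \<Rightarrow> complex" and y
  assume f: "f holomorphic_on unit_disc" and "y \<in> (f \<star> (\<lambda>z. 1 + z / 2)) ` unit_disc"
  then obtain z where z: "z \<in> unit_disc" and y: "y = f 0 + deriv f 0 * z / 2"
    by (auto simp: hadamard_linear)
  \<comment> \<open>Since \<open>cmod z < 1\<close>, this dilation is holomorphic up to the unit
    circle, as the kernel formula requires. It absorbs \<open>z\<close>: \<open>h 0 = f 0\<close>
    and \<open>deriv h 0 = deriv f 0 * z\<close>.\<close>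
  define h where "h = (\<lambda>w. f (z * w))"
  have zw: "z * w \<in> unit_disc" if "w \<in> cball 0 1" for w
    using z that mult_left_le[of "cmod w" "cmod z"] by (auto simp: norm_mult)
  have "h holomorphic_on cball 0 1"
    unfolding h_def using f zw
    by (intro holomorphic_on_compose_gen[of "(*) z" _ f, unfolded o_def] holomorphic_intros) auto
  note int = circle_integral_kernel[OF this]
  have "(f has_field_derivative deriv f 0) (at (z * 0))"
    using holomorphic_derivI[OF f, of 0] by simp
  from DERIV_chain2[where g = "(*) z" and x = 0 and s = UNIV, OF this]
  have "deriv h 0 = deriv f 0 * z"
    unfolding h_def by (intro DERIV_imp_deriv) (auto intro!: derivative_eq_intros)
  with int have int: "((\<lambda>t. h (cis t) * of_real (1 + cos t)) has_integral 2 * pi * y) {0..2*pi}"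
    by (simp add: y h_def)
  show "y \<in> closure (convex hull (f ` unit_disc))"
  proof (rule ccontr)
    \<comment> \<open>A hyperplane would strictly separate \<open>y\<close> from the hull.
      Integrating \<open>b < inner a x\<close> along the values \<open>h (cis t)\<close> against the
      nonnegative weight \<open>1 + cos t\<close>, whose total mass \<open>2 * pi\<close> comes from
      the kernel formula for the constant 1, yields the opposite inequality
      \<open>b \<le> inner a y\<close>.\<close>
    assume "y \<notin> closure (convex hull (f ` unit_disc))"
    then obtain a b where ab: "inner a y < b" "\<And>x. x \<in> closure (convex hull (f ` unit_disc)) \<Longrightarrow> b < inner a x"
      using separating_hyperplane_closed_point[of "closure (convex hull (f ` unit_disc))" y]
        convex_closure[OF convex_convex_hull] by blast
    have "((\<lambda>t. b * (1 + cos t)) has_integral b * (2 * pi)) {0..2*pi}"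
      using has_integral_mult_right[OF has_integral_Re[OF circle_integral_kernel[of "\<lambda>_. 1"]], of b] by simp
    moreover have "((\<lambda>t. inner a (h (cis t) * of_real (1 + cos t))) has_integral inner a (2 * pi * y)) {0..2*pi}"
      using has_integral_linear[OF int bounded_linear_inner_right] by (simp add: o_def)
    moreover have "b * (1 + cos t) \<le> inner a (h (cis t) * of_real (1 + cos t))" for t
    proof -
      have "h (cis t) \<in> closure (convex hull (f ` unit_disc))"
        unfolding h_def using zw[of "cis t"]
        by (intro subsetD[OF closure_subset] hull_inc imageI) auto
      from ab(2)[OF this] have "b * (1 + cos t) \<le> inner a (h (cis t)) * (1 + cos t)"
        using cos_ge_minus_one[of t] by (intro mult_right_mono) linarith+
      also have "inner a (h (cis t)) * (1 + cos t) = inner a (h (cis t) * of_real (1 + cos t))"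
        using inner_scaleR_right[of a "1 + cos t" "h (cis t)"] by (simp add: scaleR_conv_of_real mult.commute)
      finally show ?thesis .
    qed
    ultimately have "b * (2 * pi) \<le> inner a (2 * pi * y)"
      by (rule has_integral_le)
    also have "\<dots> = inner a y * (2 * pi)"
      using inner_scaleR_right[of a "2 * pi" y] by (simp add: scaleR_conv_of_real mult.commute)
    finally show False
      using ab(1) by simp
  qed
qed

section \<open>The star-function for angles near \<open>pi\<close>\<close>

lemma set_integral_deviation:
  fixes h :: "real \<Rightarrow> real"
  assumes cont: "continuous_on {a..b} h" and ab: "a \<le> b"
    and E: "E \<in> sets lebesgue" "E \<subseteq> {a..b}"
    and M: "\<And>t. t \<in> {a..b} \<Longrightarrow> \<bar>h t\<bar> \<le> M"
  shows "\<bar>(LINT t:E|lebesgue. h t) - integral {a..b} h\<bar> \<le> M * (b - a - measure lebesgue E)"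
proof -
  let ?D = "{a..b} - E"
  have D: "?D \<in> sets lebesgue"
    using E by auto
  have int: "set_integrable lebesgue {a..b} h"
    using cont by (rule absolutely_integrable_continuous_real)
  have intD: "set_integrable lebesgue ?D h" and intE: "set_integrable lebesgue E h"
    using int D E by (auto intro: set_integrable_subset)
  have "set_integrable lebesgue {a..b} (\<lambda>_. M)"
    by (rule absolutely_integrable_continuous_real) auto
  hence intM: "set_integrable lebesgue ?D (\<lambda>_. M)"
    using D by (rule set_integrable_subset) auto
  have "integral {a..b} h = (LINT t:E \<union> ?D|lebesgue. h t)"
    using set_lebesgue_integral_eq_integral(2)[OF int] E by (simp add: Un_absorb1)
  also have "\<dots> = (LINT t:E|lebesgue. h t) + (LINT t:?D|lebesgue. h t)"
    by (intro set_integral_Un intE intD) auto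
  finally have "\<bar>(LINT t:E|lebesgue. h t) - integral {a..b} h\<bar> = \<bar>LINT t:?D|lebesgue. h t\<bar>"
    by simp
  also have "\<dots> \<le> (LINT t:?D|lebesgue. \<bar>h t\<bar>)"
    using set_integral_norm_bound[OF intD] by simp
  also have "\<dots> \<le> (LINT t:?D|lebesgue. M)"
    using intD intM M by (intro set_integral_mono set_integrable_abs) auto
  also have "\<dots> = M * measure lebesgue ?D"
    by (simp add: set_lebesgue_integral_def)
  also have "measure lebesgue ?D = b - a - measure lebesgue E"
    using E ab by (subst measurable_measure_Diff) auto
  finally show ?thesis .
qed

text \<open>The half-disc excludes \<open>\<theta> = pi\<close>, so the comparison of means must be
  carried to smaller angles. An admissible \<open>E\<close> omits only measure
  \<open>2 * (pi - \<theta>)\<close>, and \<open>ln (cmod g)\<close> is bounded on the circle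
  because \<open>g\<close> is continuous and zero-free there. The resulting error bound is uniform
  in \<open>E\<close> and so passes to the supremum.\<close>

lemma baernstein_star_log_near_mean:
  fixes g :: "complex \<Rightarrow> complex"
  assumes cont: "continuous_on (sphere 0 r) g" and nz: "\<And>z. z \<in> sphere 0 r \<Longrightarrow> g z \<noteq> 0" and r: "0 < r"
    and mean: "((\<lambda>t. ln (cmod (g (rcis r t)))) has_integral I) {-pi..pi}"
  obtains M where "0 \<le> M"
    "\<And>\<theta>. 0 < \<theta> \<Longrightarrow> \<theta> \<le> pi \<Longrightarrow> baernstein_star (log_abs g) (rcis r \<theta>) \<le> ereal (I + M * (pi - \<theta>))"
    "\<And>\<theta>. 0 < \<theta> \<Longrightarrow> \<theta> \<le> pi \<Longrightarrow> ereal (I - M * (pi - \<theta>)) \<le> baernstein_star (log_abs g) (rcis r \<theta>)"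
proof -
  define h where "h = (\<lambda>t. ln (cmod (g (rcis r t))))"
  have sph: "rcis r t \<in> sphere 0 r" for t
    using r by simp
  have conth: "continuous_on {-pi..pi} h"
    unfolding h_def
    by (intro continuous_intros continuous_on_compose2[OF cont]) (use sph nz in \<open>auto simp: rcis_def intro!: continuous_intros\<close>)
  obtain M where "\<forall>t\<in>{-pi..pi}. \<bar>h t\<bar> \<le> M"
    using compact_imp_bounded[OF compact_continuous_image[OF conth]]
    by (auto simp: bounded_iff)
  hence M: "\<bar>h t\<bar> \<le> M" if "t \<in> {-pi..pi}" for t
    using that by blast
  have M0: "0 \<le> M"
    using M[of 0] by simp
  have log: "log_abs g (rcis r t) = ereal (h t)" for t
    using nz[OF sph] by (simp add: log_abs_def h_def)
  have I: "integral {-pi..pi} h = I"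
    using mean unfolding h_def by (rule integral_unique)
  have key: "ereal_integral E (\<lambda>t. log_abs g (rcis (cmod (rcis r \<theta>)) t)) = ereal (LINT t:E|lebesgue. h t) \<and>
      \<bar>(LINT t:E|lebesgue. h t) - I\<bar> \<le> 2 * M * (pi - \<theta>)"
    if "0 < \<theta>" "\<theta> \<le> pi" "E \<in> sets lebesgue" "E \<subseteq> {-pi..pi}" "emeasure lebesgue E = ennreal (2 * \<theta>)" for \<theta> E
  proof
    have "set_integrable lebesgue E h"
      using absolutely_integrable_continuous_real[OF conth] that(3,4) by (rule set_integrable_subset)
    thus "ereal_integral E (\<lambda>t. log_abs g (rcis (cmod (rcis r \<theta>)) t)) = ereal (LINT t:E|lebesgue. h t)"
      using r by (simp add: log ereal_integral_eq_set_integral)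
    have "measure lebesgue E = 2 * \<theta>"
      using that by (simp add: measure_def)
    thus "\<bar>(LINT t:E|lebesgue. h t) - I\<bar> \<le> 2 * M * (pi - \<theta>)"
      using set_integral_deviation[OF conth _ that(3,4) M] by (simp add: I algebra_simps)
  qed
  have arg: "Arg (rcis r \<theta>) = \<theta>" if "0 < \<theta>" "\<theta> \<le> pi" for \<theta>
    using r that by (intro cis_Arg_unique) (auto simp: rcis_def sgn_mult sgn_of_real)
  show ?thesis
  proof (rule that[of "2 * M"])
    fix \<theta> :: real assume \<theta>: "0 < \<theta>" "\<theta> \<le> pi"
    show "baernstein_star (log_abs g) (rcis r \<theta>) \<le> ereal (I + 2 * M * (pi - \<theta>))"
      unfolding baernstein_star_def arg[OF \<theta>]
      using key[OF \<theta>] by (intro SUP_least) (force simp: abs_le_iff)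
    \<comment> \<open>Any single admissible set bounds the supremum from below; the symmetric arc is
      a convenient one.\<close>
    have E: "{-\<theta>..\<theta>} \<in> sets lebesgue" "{-\<theta>..\<theta>} \<subseteq> {-pi..pi}" "emeasure lebesgue {-\<theta>..\<theta>} = ennreal (2 * \<theta>)"
      using \<theta> by auto
    have "ereal (I - 2 * M * (pi - \<theta>)) \<le>
        ereal_integral {-\<theta>..\<theta>} (\<lambda>t. log_abs g (rcis (cmod (rcis r \<theta>)) t))"
      using key[OF \<theta> E] by (force simp: abs_le_iff)
    also have "\<dots> \<le> baernstein_star (log_abs g) (rcis r \<theta>)"
      unfolding baernstein_star_def arg[OF \<theta>] using E by (intro SUP_upper) auto
    finally show "ereal (I - 2 * M * (pi - \<theta>)) \<le> baernstein_star (log_abs g) (rcis r \<theta>)" .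
  qed (use M0 in auto)
qed

section \<open>The shifted Koebe function and the counterexample\<close>

text \<open>The function is \<open>1 + 4 * z / (1 - z) ^ 2\<close>. After cross-multiplication, the
  difference of its values at \<open>z\<close> and \<open>w\<close> is
  \<open>4 * (z - w) * (1 - z * w)\<close>, and the last factor cannot vanish in the disc.\<close>

lemma shifted_koebe_univalent: "univalent_on (\<lambda>z. ((1 + z) / (1 - z)) ^ 2) unit_disc"
  unfolding univalent_on_def
proof
  have ne: "1 - z \<noteq> 0" if "z \<in> unit_disc" for z :: complex
    using that by auto
  show "(\<lambda>z. ((1 + z) / (1 - z)) ^ 2) holomorphic_on unit_disc"
    using ne by (intro holomorphic_intros) auto
  show "inj_on (\<lambda>z. ((1 + z) / (1 - z)) ^ 2) unit_disc"
  proof (rule inj_onI)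
    fix z w :: complex
    assume z: "z \<in> unit_disc" and w: "w \<in> unit_disc"
      and eq: "((1 + z) / (1 - z)) ^ 2 = ((1 + w) / (1 - w)) ^ 2"
    from eq ne[OF z] ne[OF w] have "(1 + z) ^ 2 * (1 - w) ^ 2 = (1 + w) ^ 2 * (1 - z) ^ 2"
      by (simp add: power_divide frac_eq_eq)
    hence "(z - w) * (1 - z * w) = 0"
      by algebra
    moreover have "cmod (z * w) < 1"
      using z w mult_strict_mono[of "cmod z" 1 "cmod w" 1] by (simp add: norm_mult)
    hence "1 - z * w \<noteq> 0" by auto
    ultimately show "z = w" by simp
  qed
qed

lemma hadamard_shifted_koebe_linear:
  "(\<lambda>z. ((1 + z) / (1 - z)) ^ 2) \<star> (\<lambda>z. 1 + z / 2) = (\<lambda>z. 1 + 2 * z)"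
proof -
  have "((\<lambda>z::complex. ((1 + z) / (1 - z)) ^ 2) has_field_derivative 4) (at 0)"
    by (auto intro!: derivative_eq_intros)
  from DERIV_imp_deriv[OF this] show ?thesis
    by (simp add: fun_eq_iff hadamard_linear)
qed

theorem theorem3:
  shows "\<exists>f F :: complex \<Rightarrow> complex.
           univalent_on f unit_disc \<and> univalent_on F unit_disc \<and> convexity_preserving F \<and>
           \<not> (\<forall>z \<in> upper_half_disc.
                 baernstein_star (log_abs (f \<star> F)) z \<le> baernstein_star (log_abs f) z)"
proof (intro exI conjI)
  let ?f = "\<lambda>z::complex. ((1 + z) / (1 - z)) ^ 2" and ?F = "\<lambda>z::complex. 1 + z / 2"
  \<comment> \<open>Any radius strictly between 1/2 and 1 would do: the circle then encloses the
    zero \<open>-1/2\<close> of \<open>1 + 2 * z\<close>, and the mean of the logarithm is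
    \<open>ln (2 * r) > 0\<close>.\<close>
  let ?r = "3 / 4 :: real"
  show f: "univalent_on ?f unit_disc"
    by (rule shifted_koebe_univalent)
  show "univalent_on ?F unit_disc"
    unfolding univalent_on_def by (intro conjI holomorphic_intros inj_onI) auto
  show "convexity_preserving ?F"
    by (rule convexity_preserving_linear)
  have nz: "?f z \<noteq> 0" if "z \<in> unit_disc" for z
    using that by (auto simp: add_eq_0_iff)
  have holf: "?f holomorphic_on unit_disc"
    using f by (simp add: univalent_on_def)
  from log_mean_value[OF holf nz, of ?r]
  have "((\<lambda>t. ln (cmod (?f (rcis ?r t)))) has_integral 0) {-pi..pi}"
    by simp
  moreover have sub: "sphere 0 ?r \<subseteq> unit_disc"
    by auto
  moreover have "continuous_on (sphere 0 ?r) ?f"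
    using holomorphic_on_imp_continuous_on[OF holf] sub by (rule continuous_on_subset)
  ultimately obtain M where M: "0 \<le> M"
    "\<And>\<theta>. 0 < \<theta> \<Longrightarrow> \<theta> \<le> pi \<Longrightarrow> baernstein_star (log_abs ?f) (rcis ?r \<theta>) \<le> ereal (0 + M * (pi - \<theta>))"
    using baernstein_star_log_near_mean[of ?r ?f 0] nz[OF subsetD[OF sub]] by (smt (verit) divide_pos_pos)
  \<comment> \<open>Reflecting in the circle moves the zero \<open>-1/2\<close> outside.\<close>
  have "cmod (1 + 2 * rcis ?r t) = cmod (3 / 2 + rcis 1 t)" for t
  proof -
    have "1 + 2 * rcis ?r t = cis t * cnj (3 / 2 + rcis 1 t)"
      by (simp add: rcis_def algebra_simps cis_cnj cis_mult)
    thus ?thesis by (simp only: norm_mult norm_cis complex_mod_cnj mult_1)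
  qed
  \<comment> \<open>The only zero of \<open>3/2 + z\<close> is \<open>-3/2\<close>, outside the open
    ball of radius 3/2, and that ball contains the unit circle.\<close>
  moreover have "((\<lambda>t. ln (cmod (3 / 2 + rcis 1 t))) has_integral 2 * pi * ln (cmod (3 / 2 + 0))) {-pi..pi}"
    by (rule log_mean_value[of _ "3 / 2"]) (auto intro!: holomorphic_intros simp: add_eq_0_iff)
  ultimately have "((\<lambda>t. ln (cmod (1 + 2 * rcis ?r t))) has_integral 2 * pi * ln (3 / 2)) {-pi..pi}"
    by simp
  moreover have "1 + 2 * z \<noteq> 0" if "z \<in> sphere 0 ?r" for z :: complex
  proof
    assume "1 + 2 * z = 0"
    hence "2 * z = - 1"
      by (simp add: add_eq_0_iff)
    hence "2 * cmod z = 1"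
      by (metis norm_mult norm_minus_cancel norm_one norm_numeral)
    with that show False by simp
  qed
  moreover have "continuous_on (sphere 0 ?r) (\<lambda>z::complex. 1 + 2 * z)"
    by (intro continuous_intros)
  ultimately obtain M' where M': "0 \<le> M'"
    "\<And>\<theta>. 0 < \<theta> \<Longrightarrow> \<theta> \<le> pi \<Longrightarrow>
      ereal (2 * pi * ln (3 / 2) - M' * (pi - \<theta>)) \<le> baernstein_star (log_abs (\<lambda>z. 1 + 2 * z)) (rcis ?r \<theta>)"
    using baernstein_star_log_near_mean[of ?r "\<lambda>z. 1 + 2 * z" "2 * pi * ln (3 / 2)"] by (smt (verit) divide_pos_pos)
  define c where "c = 2 * pi * ln (3 / 2 :: real)"
  have "c > 0"
    by (simp add: c_def)
  \<comment> \<open>The two full-circle integrals differ by \<open>c\<close>, and moving to angle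
    \<open>pi - \<delta>\<close> costs at most \<open>(M + M') * \<delta>\<close>. The summand 1
    keeps the denominator positive and makes this cost strictly less than \<open>c\<close>; the cap
    at 1 keeps the angle positive.\<close>
  define \<delta> where "\<delta> = min 1 (c / (M + M' + 1))"
  have \<delta>: "0 < \<delta>" "\<delta> < pi"
    using \<open>c > 0\<close> M(1) M'(1) pi_gt3 by (auto simp: \<delta>_def)
  have "(M + M') * \<delta> < (M + M' + 1) * \<delta>"
    using \<delta> by (simp add: algebra_simps)
  also have "\<dots> \<le> (M + M' + 1) * (c / (M + M' + 1))"
    using M(1) M'(1) by (intro mult_left_mono) (auto simp: \<delta>_def)
  also have "\<dots> = c"
    using M(1) M'(1) by simp
  finally have less: "M * \<delta> < c - M' * \<delta>"
    by (simp add: algebra_simps)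
  let ?z = "rcis ?r (pi - \<delta>)"
  have "?z \<in> upper_half_disc"
    unfolding upper_half_disc_def using \<delta> by force
  moreover have "baernstein_star (log_abs ?f) ?z < baernstein_star (log_abs (?f \<star> ?F)) ?z"
  proof -
    have "baernstein_star (log_abs ?f) ?z \<le> ereal (M * \<delta>)"
      using M(2)[of "pi - \<delta>"] \<delta> by simp
    also have "\<dots> < ereal (c - M' * \<delta>)"
      using less by simp
    also have "\<dots> \<le> baernstein_star (log_abs (?f \<star> ?F)) ?z"
      using M'(2)[of "pi - \<delta>"] \<delta> unfolding hadamard_shifted_koebe_linear c_def by simp
    finally show ?thesis .
  qed
  ultimately show "\<not> (\<forall>z \<in> upper_half_disc.
      baernstein_star (log_abs (?f \<star> ?F)) z \<le> baernstein_star (log_abs ?f) z)"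
    by (auto simp: not_le)
qed

end
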